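(* Consider an approximation function of $\Phi(\boldsymbol z,\boldsymbol v)$ based on a ReLU artificial neural network (ReLU-ANN), called $\Phi_{NN}(\boldsymbol z,\boldsymbol v)$, with $K-1$ hidden layers, weights $\boldsymbol W^k$ and biases $\boldsymbol b^k$, $k=1,\dots,K$. Assume that the approximation error is bounded, i.e., there exists $\boldsymbol\epsilon\in\mathbb{R}^m$, $\boldsymbol\epsilon>\boldsymbol 0$, such that $$|\Phi(\boldsymbol z,\boldsymbol v)-\Phi_{NN}(\boldsymbol z,\boldsymbol v)|\le\boldsymbol\epsilon$$ in a compact region $(\boldsymbol z,\boldsymbol v)\in\mathcal Z\subset\mathbb{R}^{n_z}\times\mathbb{R}^m$. Then the constraint $(\boldsymbol z,\boldsymbol v)\in\mathcal V$, where $\mathcal V=\{(\boldsymbol z,\boldsymbol v):|\Phi(\boldsymbol z,\boldsymbol v)|\le\boldsymbol u_{max}\}$, can be imposed via mixed-integer (MI) linear constraints with respect to $\boldsymbol z$ and $\boldsymbol v$.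
   Context: Vector inequalities are componentwise, and $|\boldsymbol x|=[|x_1|,\dots,|x_n|]^\top$ for $\boldsymbol x\in\mathbb{R}^n$. Setting: a nonlinear system $\dot{\boldsymbol x}=f(\boldsymbol x,\boldsymbol u)$ with state $\boldsymbol x\in\mathbb{R}^{n_x}$, input $\boldsymbol u\in\mathbb{R}^m$, $f$ Lipschitz continuous, is subject to the input constraint $|\boldsymbol u|\le\boldsymbol u_{max}$ with $\boldsymbol u_{max}\in\mathbb{R}^m$, $\boldsymbol u_{max}>\boldsymbol 0$. It is supposed that there exist a coordinate change and an input transformation which linearize the model in closed loop, so that the dynamics become $\dot{\boldsymbol z}=\boldsymbol A\boldsymbol z+\boldsymbol B\boldsymbol v$ (chains of integrators, Brunovsky canonical form), with new state $\boldsymbol z\in\mathbb{R}^{n_z}$ and new (virtual) input $\boldsymbol v\in\mathbb{R}^m$. The mapping from the virtual input to the input is denoted $\boldsymbol u=\Phi(\boldsymbol z,\boldsymbol v)$, with values in $\mathbb{R}^m$. The set $\mathcal V$ is thus the input constraint expressed in the new coordinates. ReLU-ANN: for $\boldsymbol y\in\mathbb{R}^n$ let $\sigma(\boldsymbol y)=[\max\{0,y_1\},\dots,\max\{0,y_n\}]^\top$. Let $n_k$ be the number of nodes in the $k$th layer, with weight $\boldsymbol W^k\in\mathbb{R}^{n_k\times n_{k-1}}$ and bias $\boldsymbol b^k\in\mathbb{R}^{n_k}$, $k=1,\dots,K$, where $n_0=n_z+m$ and $n_K=m$. With network input $\boldsymbol y^0=(\boldsymbol z,\boldsymbol v)$ stacked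 as a vector in $\mathbb{R}^{n_z+m}$, the network is evaluated by $\boldsymbol y^k=\sigma(\boldsymbol W^k\boldsymbol y^{k-1}+\boldsymbol b^k)$ for $k=1,\dots,K-1$ and $\boldsymbol y^K=\boldsymbol W^K\boldsymbol y^{K-1}+\boldsymbol b^K$, and the output is $\Phi_{NN}(\boldsymbol z,\boldsymbol v)=\boldsymbol y^K$. Mixed-integer linear constraints are linear (affine) equalities and inequalities in real variables and binary variables (variables restricted to $\{0,1\}$), possibly including auxiliary ones. That a constraint can be imposed via such constraints means that it can be guaranteed by ensuring a set of them. *)

theory Defs
  imports "HOL-Analysis.Abstract_Euclidean_Space" "Jordan_Normal_Form.Matrix"
begin

text \<open>
  Vectors of \<open>\<real>\<^sup>n\<close> are elements of \<^term>\<open>carrier_vec n\<close>, since the widths of the network layers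
  vary with the layer index.  The order \<open>\<le>\<close> on vectors is the componentwise one.  The strict
  order \<open><\<close> on vectors is \<^emph>\<open>not\<close> componentwise, so strict inequalities are written out by index.
  The vector \<open>|x|\<close> is \<^term>\<open>map_vec abs x\<close>.
\<close>

text \<open>The usual topology of \<open>\<real>\<^sup>n\<close>, transported from the coordinate functions to \<^term>\<open>carrier_vec n\<close>.\<close>

definition vec_topology :: "nat \<Rightarrow> real vec topology" where
  "vec_topology n =
     pullback_topology (carrier_vec n) (\<lambda>x i. if i < n then x $ i else 0) (Euclidean_space n)"

lemma topspace_vec_topology [simp]: "topspace (vec_topology n) = carrier_vec n"
  by (auto simp: vec_topology_def topspace_pullback_topology topspace_Euclidean_space)


definition relu :: "real vec \<Rightarrow> real vec" where
  "relu y = map_vec (max 0) y"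

text \<open>Layers are numbered from 1: \<open>W k\<close> and \<open>b k\<close> are used for \<open>k = 1, \<dots>, K\<close> only.\<close>

primrec hidden_layer ::
    "(nat \<Rightarrow> real mat) \<Rightarrow> (nat \<Rightarrow> real vec) \<Rightarrow> real vec \<Rightarrow> nat \<Rightarrow> real vec" where
  "hidden_layer W b x 0 = x"
| "hidden_layer W b x (Suc k) = relu (W (Suc k) *\<^sub>v hidden_layer W b x k + b (Suc k))"

definition relu_ann ::
    "nat \<Rightarrow> (nat \<Rightarrow> real mat) \<Rightarrow> (nat \<Rightarrow> real vec) \<Rightarrow> real vec \<Rightarrow> real vec" where
  "relu_ann K W b x = W K *\<^sub>v hidden_layer W b x (K - 1) + b K"


definition input_constraint_set ::
    "nat \<Rightarrow> nat \<Rightarrow> (real vec \<Rightarrow> real vec \<Rightarrow> real vec) \<Rightarrow> real vec \<Rightarrow> (real vec \<times> real vec) set" where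
  "input_constraint_set nz m \<Phi> umax =
     {(z, v). z \<in> carrier_vec nz \<and> v \<in> carrier_vec m \<and> map_vec abs (\<Phi> z v) \<le> umax}"


text \<open>
  \<open>Lin_le a c\<close> and \<open>Lin_eq a c\<close> stand for \<open>a\<^sup>T x \<le> c\<close> and \<open>a\<^sup>T x = c\<close>.
\<close>

datatype lin_constraint = Lin_le "real vec" real | Lin_eq "real vec" real

primrec lin_coeffs :: "lin_constraint \<Rightarrow> real vec" where
  "lin_coeffs (Lin_le a c) = a"
| "lin_coeffs (Lin_eq a c) = a"

primrec lin_holds :: "real vec \<Rightarrow> lin_constraint \<Rightarrow> bool" where
  "lin_holds x (Lin_le a c) \<longleftrightarrow> scalar_prod a x \<le> c"
| "lin_holds x (Lin_eq a c) \<longleftrightarrow> scalar_prod a x = c"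

text \<open>
  A finite system of mixed-integer linear constraints.  Its variables are the constrained vector
  \<open>x\<close>, then \<open>num_real\<close> auxiliary real variables, then \<open>num_bin\<close> auxiliary binary variables,
  stacked in this order.
\<close>

record mi_system =
  num_real :: nat
  num_bin :: nat
  constraints :: "lin_constraint list"

definition mi_system_over :: "nat \<Rightarrow> mi_system \<Rightarrow> bool" where
  "mi_system_over d S \<longleftrightarrow>
     (\<forall>c \<in> set (constraints S). lin_coeffs c \<in> carrier_vec (d + num_real S + num_bin S))"

definition mi_satisfies :: "real vec \<Rightarrow> mi_system \<Rightarrow> bool" where
  "mi_satisfies x S \<longleftrightarrow>
     (\<exists>w \<in> carrier_vec (num_real S). \<exists>\<delta> \<in> carrier_vec (num_bin S).
        (\<forall>i < num_bin S. \<delta> $ i \<in> {0, 1}) \<and>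
        (\<forall>c \<in> set (constraints S). lin_holds (x @\<^sub>v w @\<^sub>v \<delta>) c))"

end

theory Submission
  imports Defs
begin

text \<open>
  Every preactivation of the network is a continuous function of the input, hence bounded on the
  compact set \<open>Z\<close>.  With a bound \<open>M\<close> on \<open>|p|\<close>, the relation \<open>y = max 0 p\<close> is encoded by the big-M
  constraints \<open>p \<le> y\<close>, \<open>0 \<le> y\<close>, \<open>y \<le> p + M (1 - \<delta>)\<close>, \<open>y \<le> M \<delta>\<close> with a binary \<open>\<delta>\<close>.  The auxiliary
  real variables are the outputs of all hidden nodes, so the output of the network is affine in
  them, and by the triangle inequality it suffices to keep it within \<open>umax - \<epsilon>\<close>.
\<close>

section \<open>Continuity of coordinates and boundedness on compact sets\<close>

lemma compactin_continuous_real_bounded: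
  assumes "compactin T Z" "continuous_map T euclideanreal f"
  shows "\<exists>M. \<forall>x\<in>Z. \<bar>f x\<bar> \<le> M"
proof -
  have "compact (f ` Z)"
    using image_compactin[OF assms] by simp
  then show ?thesis
    using compact_imp_bounded by (force simp: bounded_iff)
qed

text \<open>The topology is a pullback, so the coordinate factors through the embedding into
  \<open>Euclidean_space n\<close>; for \<open>i < n\<close> the default value 0 of that embedding
  never appears.\<close>

lemma continuous_map_vec_topology_component:
  assumes "i < n"
  shows "continuous_map (vec_topology n) euclideanreal (\<lambda>x. x $ i)"
proof -
  have "continuous_map (Euclidean_space n) euclideanreal (\<lambda>y. y i)"
    unfolding Euclidean_space_def
    by (intro continuous_map_from_subtopology continuous_map_product_projection) simp
  then have "continuous_map (vec_topology n) euclideanreal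
      ((\<lambda>y. y i) \<circ> (\<lambda>x i. if i < n then x $ i else 0))"
    unfolding vec_topology_def by (rule continuous_map_pullback)
  then show ?thesis
    using assms by (simp add: o_def)
qed

text \<open>Each entry of the concatenation is a coordinate of one factor. The two functions need to
  agree on the topspace only, where the length of the first part is known to be
  \<open>n\<close>.\<close>

lemma continuous_map_append_vec_component:
  assumes "i < n + m"
  shows "continuous_map (prod_topology (vec_topology n) (vec_topology m)) euclideanreal
    (\<lambda>p. (fst p @\<^sub>v snd p) $ i)"
proof (cases "i < n")
  case True
  have "continuous_map (prod_topology (vec_topology n) (vec_topology m)) euclideanreal
      ((\<lambda>x. x $ i) \<circ> fst)"
    using True by (intro continuous_map_compose[OF continuous_map_fst]
        continuous_map_vec_topology_component)
  then show ?thesis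
    by (rule continuous_map_eq) (use True in auto)
next
  case False
  have "continuous_map (prod_topology (vec_topology n) (vec_topology m)) euclideanreal
      ((\<lambda>x. x $ (i - n)) \<circ> snd)"
    using False assms by (intro continuous_map_compose[OF continuous_map_snd]
        continuous_map_vec_topology_component) auto
  then show ?thesis
    by (rule continuous_map_eq) (use False assms in auto)
qed

section \<open>Stacked vectors and linear forms on a slice\<close>

lemma append_vec_assoc: "x @\<^sub>v y @\<^sub>v z = (x @\<^sub>v y) @\<^sub>v z"
  by (rule eq_vecI) auto

text \<open>Padding with zeros turns a row of a weight matrix, which acts on one layer, into a
  coefficient vector over all variables.\<close>

definition block_vec :: "nat \<Rightarrow> nat \<Rightarrow> real vec \<Rightarrow> real vec" where
  "block_vec D s r = vec D (\<lambda>j. if s \<le> j \<and> j < s + dim_vec r then r $ (j - s) else 0)"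

lemma block_vec_carrier [simp]: "block_vec D s r \<in> carrier_vec D"
  by (simp add: block_vec_def)

lemma scalar_prod_block_vec:
  assumes "X \<in> carrier_vec D" "s + dim_vec r \<le> D"
    and "dim_vec h = dim_vec r" "\<And>j. j < dim_vec r \<Longrightarrow> X $ (s + j) = h $ j"
  shows "block_vec D s r \<bullet> X = r \<bullet> h"
proof -
  have "block_vec D s r \<bullet> X =
      (\<Sum>j\<in>{0..<D}. if s \<le> j \<and> j < s + dim_vec r then r $ (j - s) * X $ j else 0)"
    using assms(1) by (auto simp: scalar_prod_def block_vec_def intro!: sum.cong)
  also have "\<dots> = (\<Sum>j\<in>{s..<s + dim_vec r}. r $ (j - s) * X $ j)"
    using assms(2) by (intro sum.mono_neutral_cong_right) auto
  also have "\<dots> = (\<Sum>j\<in>{0..<dim_vec r}. r $ j * X $ (s + j))"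
    using sum.shift_bounds_nat_ivl[of "\<lambda>j. r $ (j - s) * X $ j" 0 s "dim_vec r"]
    by (simp add: add.commute)
  also have "\<dots> = r \<bullet> h"
    using assms(3,4) by (simp add: scalar_prod_def)
  finally show ?thesis .
qed

section \<open>Big-M constraints of a single node\<close>

text \<open>Here \<open>y\<close> and \<open>\<delta>\<close> are indices of variables, and the
  preactivation is the affine form \<open>a \<bullet> X + c\<close>, whose constant moves to the
  right-hand sides.\<close>

definition relu_constraints ::
    "nat \<Rightarrow> real vec \<Rightarrow> real \<Rightarrow> real \<Rightarrow> nat \<Rightarrow> nat \<Rightarrow> lin_constraint list" where
  "relu_constraints D a c M y \<delta> =
     [Lin_le (a - unit_vec D y) (- c),
      Lin_le (- unit_vec D y) 0,
      Lin_le (unit_vec D y - a + M \<cdot>\<^sub>v unit_vec D \<delta>) (c + M),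
      Lin_le (unit_vec D y - M \<cdot>\<^sub>v unit_vec D \<delta>) 0]"

lemma relu_constraints_carrier:
  assumes "a \<in> carrier_vec D" "c' \<in> set (relu_constraints D a c M y \<delta>)"
  shows "lin_coeffs c' \<in> carrier_vec D"
  using assms by (auto simp: relu_constraints_def)

lemma relu_constraints_iff:
  fixes X :: "real vec"
  assumes "X \<in> carrier_vec D" "a \<in> carrier_vec D" "y < D" "\<delta> < D"
  shows "(\<forall>c'\<in>set (relu_constraints D a c M y \<delta>). lin_holds X c') \<longleftrightarrow>
    a \<bullet> X + c \<le> X $ y \<and> 0 \<le> X $ y \<and> X $ y \<le> a \<bullet> X + c + M * (1 - X $ \<delta>) \<and> X $ y \<le> M * X $ \<delta>"
  using assms
  by (auto simp: relu_constraints_def minus_scalar_prod_distrib[of _ D]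
      add_scalar_prod_distrib[of _ D] algebra_simps)

text \<open>If the binary is 0, the output is squeezed to 0 and the preactivation lies below it. If
  it is 1, the output is squeezed to the preactivation, which is then nonnegative.\<close>

lemma relu_constraints_imp_max:
  fixes X :: "real vec"
  assumes "X \<in> carrier_vec D" "a \<in> carrier_vec D" "y < D" "\<delta> < D" "X $ \<delta> \<in> {0, 1}"
    and "\<forall>c'\<in>set (relu_constraints D a c M y \<delta>). lin_holds X c'"
  shows "X $ y = max 0 (a \<bullet> X + c)"
  using assms(5,6) relu_constraints_iff[OF assms(1-4)] by auto

text \<open>The binary marks an active node. An active node needs the preactivation to be at most
  \<open>M\<close>, an inactive one needs it to be at least \<open>- M\<close>.\<close>

lemma max_imp_relu_constraints:
  fixes X :: "real vec"
  assumes "X \<in> carrier_vec D" "a \<in> carrier_vec D" "y < D" "\<delta> < D"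
    and "X $ y = max 0 (a \<bullet> X + c)" "X $ \<delta> = of_bool (0 < X $ y)" "\<bar>a \<bullet> X + c\<bar> \<le> M"
  shows "\<forall>c'\<in>set (relu_constraints D a c M y \<delta>). lin_holds X c'"
  unfolding relu_constraints_iff[OF assms(1-4)] using assms(5-7) by auto

definition abs_constraints :: "real vec \<Rightarrow> real \<Rightarrow> real \<Rightarrow> lin_constraint list" where
  "abs_constraints a c r = [Lin_le a (r - c), Lin_le (- a) (r + c)]"

lemma abs_constraints_iff:
  assumes "X \<in> carrier_vec D" "a \<in> carrier_vec D"
  shows "(\<forall>c'\<in>set (abs_constraints a c r). lin_holds X c') \<longleftrightarrow> \<bar>a \<bullet> X + c\<bar> \<le> r"
  using assms by (auto simp: abs_constraints_def)

section \<open>Layers of the network, their continuity and bounds\<close>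

locale relu_network =
  fixes K :: nat and n :: "nat \<Rightarrow> nat" and W :: "nat \<Rightarrow> real mat" and b :: "nat \<Rightarrow> real vec"
  assumes K: "1 \<le> K"
    and weights: "\<forall>k \<in> {1..K}. W k \<in> carrier_mat (n k) (n (k - 1))"
    and biases: "\<forall>k \<in> {1..K}. b k \<in> carrier_vec (n k)"
begin

abbreviation layer :: "real vec \<Rightarrow> nat \<Rightarrow> real vec" where
  "layer \<equiv> hidden_layer W b"

text \<open>Indexed by the layer that is read, so it belongs to layer \<open>k + 1\<close>. For
  \<open>k = K - 1\<close> it is the network output, since the last layer applies no ReLU.\<close>

definition preact :: "real vec \<Rightarrow> nat \<Rightarrow> real vec" where
  "preact x k = W (Suc k) *\<^sub>v layer x k + b (Suc k)"

lemma relu_ann_eq_preact: "relu_ann K W b x = preact x (K - 1)"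
  using K by (simp add: relu_ann_def preact_def)

lemma layer_Suc: "layer x (Suc k) = relu (preact x k)"
  by (simp add: preact_def)

lemma preact_carrier:
  assumes "k < K"
  shows "preact x k \<in> carrier_vec (n (Suc k))"
proof -
  have "W (Suc k) \<in> carrier_mat (n (Suc k)) (n k)" "b (Suc k) \<in> carrier_vec (n (Suc k))"
    using weights biases assms by force+
  then show ?thesis
    by (auto simp: preact_def intro!: carrier_vecI)
qed

lemma layer_carrier: "x \<in> carrier_vec (n 0) \<Longrightarrow> k < K \<Longrightarrow> layer x k \<in> carrier_vec (n k)"
  using preact_carrier by (cases k) (auto simp: layer_Suc relu_def simp del: hidden_layer.simps(2))

lemma layer_Suc_component:
  "k < K \<Longrightarrow> i < n (Suc k) \<Longrightarrow> layer x (Suc k) $ i = max 0 (preact x k $ i)"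
  using preact_carrier[of k x] by (simp add: layer_Suc relu_def del: hidden_layer.simps(2))

lemma preact_component:
  assumes "k < K" "i < n (Suc k)"
  shows "preact x k $ i = row (W (Suc k)) i \<bullet> layer x k + b (Suc k) $ i"
proof -
  have "W (Suc k) \<in> carrier_mat (n (Suc k)) (n k)" "b (Suc k) \<in> carrier_vec (n (Suc k))"
    using weights biases assms(1) by force+
  then show ?thesis
    using assms(2) by (simp add: preact_def)
qed

lemma row_dim: "k < K \<Longrightarrow> dim_vec (row (W (Suc k)) i) = n k"
  using weights by force

text \<open>A preactivation is a finite sum of constant multiples of the layer entries plus a
  constant. The input is a map \<open>f\<close> on a space \<open>T\<close> because the compact set
  consists of pairs while the network reads their concatenation.\<close>

lemma continuous_map_preact_if_layer:
  assumes "k < K" "i < n (Suc k)" "\<And>t. t \<in> topspace T \<Longrightarrow> f t \<in> carrier_vec (n 0)"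
    and "\<And>j. j < n k \<Longrightarrow> continuous_map T euclideanreal (\<lambda>t. layer (f t) k $ j)"
  shows "continuous_map T euclideanreal (\<lambda>t. preact (f t) k $ i)"
proof -
  have "continuous_map T euclideanreal
      (\<lambda>t. (\<Sum>j\<in>{0..<n k}. row (W (Suc k)) i $ j * layer (f t) k $ j) + b (Suc k) $ i)"
    using assms(4)
    by (intro continuous_map_add continuous_map_sum continuous_map_real_mult) auto
  then show ?thesis
    by (rule continuous_map_eq)
      (use assms(1,2) carrier_vecD[OF layer_carrier[OF assms(3) assms(1)]] in
        \<open>auto simp: preact_component scalar_prod_def\<close>)
qed

lemma continuous_map_layer:
  assumes "\<And>t. t \<in> topspace T \<Longrightarrow> f t \<in> carrier_vec (n 0)"
    and "\<And>j. j < n 0 \<Longrightarrow> continuous_map T euclideanreal (\<lambda>t. f t $ j)"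
    and "k < K" "i < n k"
  shows "continuous_map T euclideanreal (\<lambda>t. layer (f t) k $ i)"
  using assms(3,4)
proof (induction k arbitrary: i)
  case 0
  then show ?case
    using assms(2) by simp
next
  case (Suc k)
  then have "continuous_map T euclideanreal (\<lambda>t. preact (f t) k $ i)"
    using assms(1) by (intro continuous_map_preact_if_layer) auto
  then have "continuous_map T euclideanreal (\<lambda>t. max 0 (preact (f t) k $ i))"
    by (intro continuous_map_real_max) auto
  then show ?case
    using Suc.prems by (simp add: layer_Suc_component del: hidden_layer.simps(2))
qed

lemma preact_bounded:
  assumes "compactin T Z" "\<And>t. t \<in> topspace T \<Longrightarrow> f t \<in> carrier_vec (n 0)"
    and "\<And>j. j < n 0 \<Longrightarrow> continuous_map T euclideanreal (\<lambda>t. f t $ j)"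
    and "k < K" "i < n (Suc k)"
  shows "\<exists>M. \<forall>t\<in>Z. \<bar>preact (f t) k $ i\<bar> \<le> M"
  using assms
  by (intro compactin_continuous_real_bounded[OF assms(1)] continuous_map_preact_if_layer
      continuous_map_layer) auto

section \<open>Positions of the nodes among the stacked variables\<close>

text \<open>The start of the slice of layer \<open>k\<close>, where the input counts as layer
  0.\<close>

definition offset :: "nat \<Rightarrow> nat" where
  "offset k = sum n {..<k}"

lemma offset_Suc: "offset (Suc k) = offset k + n k"
  by (simp add: offset_def)

lemma offset_mono: "k \<le> l \<Longrightarrow> offset k \<le> offset l"
  unfolding offset_def by (intro sum_mono2) auto

lemma offset_less: "k < l \<Longrightarrow> i < n k \<Longrightarrow> offset k + i < offset l"
  using offset_mono[of "Suc k" l] by (simp add: offset_Suc)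

text \<open>The true outputs of layers 1 to \<open>k\<close>, later the witness for the auxiliary
  real variables. It starts empty because the input is stacked separately.\<close>

fun hidden_stack :: "real vec \<Rightarrow> nat \<Rightarrow> real vec" where
  "hidden_stack x 0 = vec 0 (\<lambda>_. 0)"
| "hidden_stack x (Suc k) = hidden_stack x k @\<^sub>v layer x (Suc k)"

text \<open>The prefix sum up to layer \<open>k\<close> includes \<open>n 0\<close>, so the
  truncated subtraction is exact.\<close>

lemma hidden_stack_carrier:
  assumes "x \<in> carrier_vec (n 0)" "k < K"
  shows "hidden_stack x k \<in> carrier_vec (offset (Suc k) - n 0)"
  using assms(2)
proof (induction k)
  case 0
  then show ?case
    by (simp add: offset_def)
next
  case (Suc k)
  have "n 0 \<le> offset (Suc k)"
    using offset_mono[of 1 "Suc k"] by (simp add: offset_def)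
  then show ?case
    using Suc layer_carrier[OF assms(1), of "Suc k"]
    by (auto simp: offset_Suc simp del: hidden_layer.simps(2) intro!: carrier_vecI)
qed

lemma hidden_stack_component:
  assumes "x \<in> carrier_vec (n 0)" "k < K" "l \<le> k" "i < n l"
  shows "(x @\<^sub>v hidden_stack x k) $ (offset l + i) = layer x l $ i"
  using assms(2,3)
proof (induction k)
  case 0
  then show ?case
    using assms(1,4) by (simp add: offset_def)
next
  case (Suc k)
  let ?Y = "x @\<^sub>v hidden_stack x k" and ?h = "layer x (Suc k)"
  have le: "n 0 \<le> offset (Suc k)"
    using offset_mono[of 1 "Suc k"] by (simp add: offset_def)
  have Y: "?Y \<in> carrier_vec (offset (Suc k))"
    using append_carrier_vec[OF assms(1) hidden_stack_carrier[OF assms(1), of k]] Suc.prems le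
    by simp
  have h: "?h \<in> carrier_vec (n (Suc k))"
    using layer_carrier[OF assms(1)] Suc.prems by blast
  \<comment> \<open>Reassociating puts the new layer behind a vector of length
    \<open>offset (Suc k)\<close>, so earlier slices keep their positions.\<close>
  have "x @\<^sub>v hidden_stack x (Suc k) = ?Y @\<^sub>v ?h"
    unfolding hidden_stack.simps(2) by (rule append_vec_assoc)
  moreover have "(?Y @\<^sub>v ?h) $ (offset l + i) = layer x l $ i"
  proof (cases "l = Suc k")
    case True
    then show ?thesis
      using Y h assms(4) by (simp add: carrier_vecD del: index_append_vec(2) hidden_layer.simps(2))
  next
    case False
    then have "offset l + i < offset (Suc k)"
      using Suc.prems assms(4) by (intro offset_less) auto
    then show ?thesis
      using Y h False Suc by (simp add: carrier_vecD del: index_append_vec(2) hidden_layer.simps(2))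
  qed
  ultimately show ?case
    by (rule trans[OF arg_cong])
qed

text \<open>\<open>offset K\<close> counts layers 0 to \<open>K - 1\<close>; the output layer gets
  no variables.\<close>

definition num_hidden :: nat where
  "num_hidden = offset K - n 0"

lemma offset_K: "offset K = n 0 + num_hidden"
  using offset_mono[OF K] by (simp add: num_hidden_def offset_def)

definition num_vars :: nat where
  "num_vars = n 0 + num_hidden + num_hidden"

lemma variables_carrier:
  assumes "x \<in> carrier_vec (n 0)" "w \<in> carrier_vec num_hidden" "\<delta> \<in> carrier_vec num_hidden"
  shows "x @\<^sub>v w @\<^sub>v \<delta> \<in> carrier_vec num_vars"
  using append_carrier_vec[OF assms(1) append_carrier_vec[OF assms(2,3)]]
  by (simp only: num_vars_def add.assoc)

section \<open>The mixed-integer system of the network\<close>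

definition node_coeffs :: "nat \<Rightarrow> nat \<Rightarrow> real vec" where
  "node_coeffs k i = block_vec num_vars (offset k) (row (W (Suc k)) i)"

text \<open>
  Node \<open>i\<close> of hidden layer \<open>k + 1\<close> is variable \<open>offset (k + 1) + i\<close>.  Since the binary variables
  come after all \<open>n 0 + num_hidden\<close> real ones, and the \<open>n 0\<close> inputs have none, its binary variable
  is exactly \<open>num_hidden\<close> places further.
\<close>

definition network_constraints :: "(nat \<Rightarrow> nat \<Rightarrow> real) \<Rightarrow> lin_constraint list" where
  "network_constraints M = concat [relu_constraints num_vars (node_coeffs k i) (b (Suc k) $ i) (M k i)
       (offset (Suc k) + i) (num_hidden + (offset (Suc k) + i)). k \<leftarrow> [0..<K - 1], i \<leftarrow> [0..<n (Suc k)]]"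

definition output_constraints :: "real vec \<Rightarrow> lin_constraint list" where
  "output_constraints r = concat [abs_constraints (node_coeffs (K - 1) i) (b K $ i) (r $ i). i \<leftarrow> [0..<n K]]"

definition network_system :: "(nat \<Rightarrow> nat \<Rightarrow> real) \<Rightarrow> real vec \<Rightarrow> mi_system" where
  "network_system M r = \<lparr>num_real = num_hidden, num_bin = num_hidden,
     constraints = network_constraints M @ output_constraints r\<rparr>"

lemma node_coeffs_carrier: "node_coeffs k i \<in> carrier_vec num_vars"
  by (simp add: node_coeffs_def)

lemma mi_system_over_network_system: "mi_system_over (n 0) (network_system M r)"
  using relu_constraints_carrier[OF node_coeffs_carrier] node_coeffs_carrier
  by (auto simp: mi_system_over_def network_system_def network_constraints_def
      output_constraints_def abs_constraints_def num_vars_def)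

lemma network_constraints_hold_iff:
  "(\<forall>c\<in>set (network_constraints M). lin_holds X c) \<longleftrightarrow>
    (\<forall>k<K - 1. \<forall>i<n (Suc k). \<forall>c\<in>set (relu_constraints num_vars (node_coeffs k i) (b (Suc k) $ i)
      (M k i) (offset (Suc k) + i) (num_hidden + (offset (Suc k) + i))). lin_holds X c)"
  by (fastforce simp: network_constraints_def)

text \<open>Only the slice of layer \<open>k\<close> has to carry the true values, so the identity
  is available in an induction in which later slices are still unknown.\<close>

lemma node_coeffs_preact:
  assumes "x \<in> carrier_vec (n 0)" "X \<in> carrier_vec num_vars" "k < K" "i < n (Suc k)"
    and "\<And>j. j < n k \<Longrightarrow> X $ (offset k + j) = layer x k $ j"
  shows "node_coeffs k i \<bullet> X + b (Suc k) $ i = preact x k $ i"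
proof -
  have "offset k + n k \<le> num_vars"
    using offset_mono[of "Suc k" K] assms(3) offset_K by (simp add: offset_Suc num_vars_def)
  then have "node_coeffs k i \<bullet> X = row (W (Suc k)) i \<bullet> layer x k"
    unfolding node_coeffs_def
    using assms row_dim[OF assms(3)] layer_carrier[OF assms(1,3)]
    by (intro scalar_prod_block_vec) auto
  then show ?thesis
    using preact_component[OF assms(3,4)] by simp
qed

lemma output_constraints_hold_iff:
  assumes "x \<in> carrier_vec (n 0)" "X \<in> carrier_vec num_vars" "r \<in> carrier_vec (n K)"
    and "\<And>j. j < n (K - 1) \<Longrightarrow> X $ (offset (K - 1) + j) = layer x (K - 1) $ j"
  shows "(\<forall>c\<in>set (output_constraints r). lin_holds X c) \<longleftrightarrow> map_vec abs (relu_ann K W b x) \<le> r"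
proof -
  have out: "node_coeffs (K - 1) i \<bullet> X + b K $ i = relu_ann K W b x $ i" if "i < n K" for i
    using node_coeffs_preact[OF assms(1,2), of "K - 1" i] assms(4) that K
    by (simp add: relu_ann_eq_preact)
  have "(\<forall>c\<in>set (output_constraints r). lin_holds X c) \<longleftrightarrow>
      (\<forall>i<n K. \<forall>c\<in>set (abs_constraints (node_coeffs (K - 1) i) (b K $ i) (r $ i)). lin_holds X c)"
    by (fastforce simp: output_constraints_def)
  also have "\<dots> \<longleftrightarrow> (\<forall>i<n K. \<bar>relu_ann K W b x $ i\<bar> \<le> r $ i)"
    using abs_constraints_iff[OF assms(2) node_coeffs_carrier] out by simp
  also have "\<dots> \<longleftrightarrow> map_vec abs (relu_ann K W b x) \<le> r"
    using preact_carrier[of "K - 1" x] assms(3) K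
    by (auto simp: relu_ann_eq_preact less_eq_vec_def)
  finally show ?thesis .
qed

section \<open>Feasible assignments and the true layer values\<close>

text \<open>Forward induction over the layers: once slice \<open>k\<close> is correct, the affine
  forms of the next layer are its true preactivations, and the node constraints force slice
  \<open>k + 1\<close>.\<close>

lemma network_constraints_determine_layers:
  assumes "x \<in> carrier_vec (n 0)" "w \<in> carrier_vec num_hidden" "\<delta> \<in> carrier_vec num_hidden"
    and bin: "\<forall>i<num_hidden. \<delta> $ i \<in> {0, 1}"
    and sat: "\<forall>c\<in>set (network_constraints M). lin_holds (x @\<^sub>v w @\<^sub>v \<delta>) c"
    and "k < K" "i < n k"
  shows "(x @\<^sub>v w @\<^sub>v \<delta>) $ (offset k + i) = layer x k $ i"
  using assms(6,7)
proof (induction k arbitrary: i)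
  case 0
  then show ?case
    using assms(1-3) by (simp add: offset_def index_append_vec)
next
  case (Suc k)
  let ?X = "x @\<^sub>v w @\<^sub>v \<delta>" and ?y = "offset (Suc k) + i"
  have X: "?X \<in> carrier_vec num_vars"
    using variables_carrier[OF assms(1-3)] .
  \<comment> \<open>As \<open>Suc k < K\<close>, the node is hidden, so its variable lies after the
    inputs and before the binaries.\<close>
  have y: "?y < n 0 + num_hidden" "n 0 \<le> ?y"
    using offset_less[OF Suc.prems] offset_mono[of 1 "Suc k"] offset_K by (auto simp: offset_def)
  have "?X $ (num_hidden + ?y) = \<delta> $ (?y - n 0)"
    using y assms(1-3) by (auto simp: index_append_vec)
  then have "?X $ (num_hidden + ?y) \<in> {0, 1}"
    using bin y by auto
  moreover have "k < K - 1"
    using Suc.prems by simp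
  then have "\<forall>c\<in>set (relu_constraints num_vars (node_coeffs k i) (b (Suc k) $ i) (M k i)
      ?y (num_hidden + ?y)). lin_holds ?X c"
    using sat Suc.prems unfolding network_constraints_hold_iff by blast
  moreover have "?y < num_vars" "num_hidden + ?y < num_vars"
    using y by (auto simp: num_vars_def)
  ultimately have "?X $ ?y = max 0 (node_coeffs k i \<bullet> ?X + b (Suc k) $ i)"
    by (intro relu_constraints_imp_max[OF X node_coeffs_carrier])
  also have "\<dots> = layer x (Suc k) $ i"
    using node_coeffs_preact[OF assms(1) X, of k i] Suc layer_Suc_component[of k i x] by auto
  finally show ?case .
qed

lemma network_constraints_satisfiable:
  assumes "x \<in> carrier_vec (n 0)"
    and M: "\<And>k i. k < K - 1 \<Longrightarrow> i < n (Suc k) \<Longrightarrow> \<bar>preact x k $ i\<bar> \<le> M k i"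
  obtains w \<delta> where "w \<in> carrier_vec num_hidden" "\<delta> \<in> carrier_vec num_hidden"
    "\<forall>i<num_hidden. \<delta> $ i \<in> {0, 1}"
    "\<forall>c\<in>set (network_constraints M). lin_holds (x @\<^sub>v w @\<^sub>v \<delta>) c"
proof
  \<comment> \<open>The witnesses are the true hidden outputs and, in the same order, the indicators
    of the active nodes.\<close>
  define w where "w = hidden_stack x (K - 1)"
  define \<delta> where "\<delta> = map_vec (\<lambda>t. of_bool (0 < t) :: real) w"
  let ?X = "x @\<^sub>v w @\<^sub>v \<delta>"
  show w: "w \<in> carrier_vec num_hidden"
    using hidden_stack_carrier[OF assms(1), of "K - 1"] K by (simp add: w_def num_hidden_def)
  then show \<delta>: "\<delta> \<in> carrier_vec num_hidden"
    by (simp add: \<delta>_def)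
  show "\<forall>i<num_hidden. \<delta> $ i \<in> {0, 1}"
    using w by (auto simp: \<delta>_def)
  have X: "?X \<in> carrier_vec num_vars"
    using variables_carrier[OF assms(1) w \<delta>] .
  have Xw: "?X $ j = (x @\<^sub>v w) $ j" if "j < n 0 + num_hidden" for j
    using assms(1) w \<delta> that by (auto simp: index_append_vec)
  have layer: "?X $ (offset k + i) = layer x k $ i" if "k < K" "i < n k" for k i
    using Xw[of "offset k + i"] offset_less[OF that] offset_K that
      hidden_stack_component[OF assms(1), of "K - 1" k i]
    by (simp add: w_def)
  have "\<forall>c\<in>set (relu_constraints num_vars (node_coeffs k i) (b (Suc k) $ i)
      (M k i) (offset (Suc k) + i) (num_hidden + (offset (Suc k) + i))). lin_holds ?X c"
    if k: "k < K - 1" and i: "i < n (Suc k)" for k i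
  proof (rule max_imp_relu_constraints[OF X node_coeffs_carrier])
    let ?y = "offset (Suc k) + i"
    have y: "?y < n 0 + num_hidden" "n 0 \<le> ?y"
      using offset_less[of "Suc k" K i] offset_mono[of 1 "Suc k"] offset_K k i
      by (auto simp: offset_def)
    then show "?y < num_vars" "num_hidden + ?y < num_vars"
      by (auto simp: num_vars_def)
    have p: "node_coeffs k i \<bullet> ?X + b (Suc k) $ i = preact x k $ i"
      using k i layer by (intro node_coeffs_preact[OF assms(1) X]) auto
    show "?X $ ?y = max 0 (node_coeffs k i \<bullet> ?X + b (Suc k) $ i)"
      using layer[of "Suc k" i] layer_Suc_component[of k i x] k i p by auto
    show "\<bar>node_coeffs k i \<bullet> ?X + b (Suc k) $ i\<bar> \<le> M k i"
      using M[OF k i] p by simp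
    show "?X $ (num_hidden + ?y) = of_bool (0 < ?X $ ?y)"
      using y assms(1) w \<delta> by (auto simp: index_append_vec \<delta>_def)
  qed
  then show "\<forall>c\<in>set (network_constraints M). lin_holds ?X c"
    unfolding network_constraints_hold_iff by blast
qed

text \<open>Some assignment satisfies the network constraints, and every such assignment carries the
  true layers. The bound \<open>M\<close> enters through the existence.\<close>

lemma mi_satisfies_network_system_iff:
  assumes "x \<in> carrier_vec (n 0)" "r \<in> carrier_vec (n K)"
    and M: "\<And>k i. k < K - 1 \<Longrightarrow> i < n (Suc k) \<Longrightarrow> \<bar>preact x k $ i\<bar> \<le> M k i"
  shows "mi_satisfies x (network_system M r) \<longleftrightarrow> map_vec abs (relu_ann K W b x) \<le> r"
proof -
  \<comment> \<open>The truth of the output constraints does not depend on the assignment chosen,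
    which gives both directions.\<close>
  have output_iff: "(\<forall>c\<in>set (output_constraints r). lin_holds (x @\<^sub>v w @\<^sub>v \<delta>) c) \<longleftrightarrow>
      map_vec abs (relu_ann K W b x) \<le> r"
    if "w \<in> carrier_vec num_hidden" "\<delta> \<in> carrier_vec num_hidden" "\<forall>i<num_hidden. \<delta> $ i \<in> {0, 1}"
      "\<forall>c\<in>set (network_constraints M). lin_holds (x @\<^sub>v w @\<^sub>v \<delta>) c" for w \<delta>
  proof (rule output_constraints_hold_iff[OF assms(1) _ assms(2)])
    show "x @\<^sub>v w @\<^sub>v \<delta> \<in> carrier_vec num_vars"
      using variables_carrier[OF assms(1) that(1,2)] .
  qed (use network_constraints_determine_layers[OF assms(1) that] K in auto)
  obtain w \<delta> where "w \<in> carrier_vec num_hidden" "\<delta> \<in> carrier_vec num_hidden"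
    "\<forall>i<num_hidden. \<delta> $ i \<in> {0, 1}"
    "\<forall>c\<in>set (network_constraints M). lin_holds (x @\<^sub>v w @\<^sub>v \<delta>) c"
    using network_constraints_satisfiable[OF assms(1) M] by blast
  then show ?thesis
    using output_iff unfolding mi_satisfies_def network_system_def
    by (simp add: ball_Un) blast
qed

end

section \<open>From the network output to the input constraint\<close>

theorem proposition1:
  fixes nz m K :: nat
    and n :: "nat \<Rightarrow> nat"
    and W :: "nat \<Rightarrow> real mat"
    and b :: "nat \<Rightarrow> real vec"
    and \<Phi> :: "real vec \<Rightarrow> real vec \<Rightarrow> real vec"
    and umax \<epsilon> :: "real vec"
    and Z :: "(real vec \<times> real vec) set"
  assumes umax: "umax \<in> carrier_vec m" "\<forall>i<m. 0 < umax $ i"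
    and Phi: "\<forall>z \<in> carrier_vec nz. \<forall>v \<in> carrier_vec m. \<Phi> z v \<in> carrier_vec m"
    and K: "1 \<le> K"
    and widths: "n 0 = nz + m" "n K = m"
    and weights: "\<forall>k \<in> {1..K}. W k \<in> carrier_mat (n k) (n (k - 1))"
    and biases: "\<forall>k \<in> {1..K}. b k \<in> carrier_vec (n k)"
    and Z: "compactin (prod_topology (vec_topology nz) (vec_topology m)) Z"
    and eps: "\<epsilon> \<in> carrier_vec m" "\<forall>i<m. 0 < \<epsilon> $ i"
    and err: "\<forall>(z, v) \<in> Z. map_vec abs (\<Phi> z v - relu_ann K W b (z @\<^sub>v v)) \<le> \<epsilon>"
  shows "\<exists>S. mi_system_over (nz + m) S \<and>
           (\<forall>(z, v) \<in> Z. mi_satisfies (z @\<^sub>v v) S \<longrightarrow>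
              (z, v) \<in> input_constraint_set nz m \<Phi> umax) \<and>
           (\<forall>(z, v) \<in> Z. mi_satisfies (z @\<^sub>v v) S \<longleftrightarrow>
              map_vec abs (relu_ann K W b (z @\<^sub>v v)) \<le> umax - \<epsilon>)"
proof -
  interpret relu_network K n W b
    by unfold_locales fact+
  let ?T = "prod_topology (vec_topology nz) (vec_topology m)"
  have Z_sub: "z \<in> carrier_vec nz" "v \<in> carrier_vec m" if "(z, v) \<in> Z" for z v
    using compactin_subset_topspace[OF Z] that by auto
  \<comment> \<open>The range conditions stand inside the existential, so that a bound can be chosen
    for all \<open>k\<close> and \<open>i\<close> at once.\<close>
  have "\<forall>k i. \<exists>B. k < K \<and> i < n (Suc k) \<longrightarrow> (\<forall>p\<in>Z. \<bar>preact (fst p @\<^sub>v snd p) k $ i\<bar> \<le> B)"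
    using preact_bounded[OF Z, of "\<lambda>p. fst p @\<^sub>v snd p"] widths(1)
      continuous_map_append_vec_component[of _ nz m]
    by auto
  then obtain M where "\<And>k i p. k < K \<Longrightarrow> i < n (Suc k) \<Longrightarrow> p \<in> Z \<Longrightarrow>
      \<bar>preact (fst p @\<^sub>v snd p) k $ i\<bar> \<le> M k i"
    by metis
  then have M: "\<bar>preact (z @\<^sub>v v) k $ i\<bar> \<le> M k i" if "(z, v) \<in> Z" "k < K" "i < n (Suc k)" for z v k i
    using that by fastforce
  have iff: "mi_satisfies (z @\<^sub>v v) (network_system M (umax - \<epsilon>)) \<longleftrightarrow>
      map_vec abs (relu_ann K W b (z @\<^sub>v v)) \<le> umax - \<epsilon>" if "(z, v) \<in> Z" for z v
    using Z_sub[OF that] M[OF that] umax(1) eps(1) widths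
    by (intro mi_satisfies_network_system_iff) auto
  have "(z, v) \<in> input_constraint_set nz m \<Phi> umax"
    if zv: "(z, v) \<in> Z" and le: "map_vec abs (relu_ann K W b (z @\<^sub>v v)) \<le> umax - \<epsilon>" for z v
  proof -
    define N where "N = relu_ann K W b (z @\<^sub>v v)"
    have N: "N \<in> carrier_vec m"
      using preact_carrier[of "K - 1"] K widths(2) by (simp add: N_def relu_ann_eq_preact)
    have P: "\<Phi> z v \<in> carrier_vec m"
      using Phi Z_sub[OF zv] by blast
    have "map_vec abs (\<Phi> z v - N) \<le> \<epsilon>"
      using err zv by (auto simp: N_def)
    \<comment> \<open>The error \<open>\<epsilon>\<close> uses up exactly the margin by which the
      output bound was tightened.\<close>
    then have "\<bar>\<Phi> z v $ i\<bar> \<le> umax $ i" if "i < m" for i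
      using le N P that umax(1) eps(1) by (fastforce simp: less_eq_vec_def N_def[symmetric])
    then show ?thesis
      using Z_sub[OF zv] P umax(1) by (auto simp: input_constraint_set_def less_eq_vec_def)
  qed
  then show ?thesis
    using iff mi_system_over_network_system[of M "umax - \<epsilon>"] widths(1) by fastforce
qed

end
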